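(* Let $F\in\mathrm{Dom}(D)$ with $F>\eta$ almost surely for some $\eta>0$. Then $$\mathrm{Ent}[F]\le E\left[\frac1F\|DF\|_{\ell^2(\mathbb{N})}^2\right].$$
   Context: $\mathbb{N}=\{0,1,2,\ldots\}$. Let $(p_k)_{k\in\mathbb{N}}$ be a deterministic sequence in $(0,1)$ and $q_k=1-p_k$. Let $\Omega=\{-1,1\}^{\mathbb{N}}$ with its product $\sigma$-algebra, let $X_k:\Omega\to\{-1,1\}$ be the canonical projections, and let $\mathbb{P}$ be the product probability measure under which the $X_k$ are independent with $\mathbb{P}(X_k=1)=p_k$, $\mathbb{P}(X_k=-1)=q_k$. For $F:\Omega\to\mathbb{R}$, $D_kF(\omega)=\sqrt{p_kq_k}\,(F(\omega_+^k)-F(\omega_-^k))$, where $\omega_\pm^k$ is $\omega$ with its $k$-th coordinate replaced by $\pm1$, and $DF=(D_kF)_{k\in\mathbb{N}}$. $\mathrm{Dom}(D)$ is the space of $F\in L^2(\Omega)$ such that $E[\|DF\|_{\ell^2(\mathbb{N})}^2]<\infty$. The entropy of $F>0$ is $\mathrm{Ent}[F]=E[F\log F]-E[F]\log E[F]$. *)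

theory Defs
  imports "HOL-Probability.Probability"
begin

definition Omega :: "(nat \<Rightarrow> int) set"
  where "Omega = UNIV \<rightarrow>\<^sub>E {-1, 1}"

definition coin_law :: "real \<Rightarrow> int measure"
  where "coin_law r = point_measure {-1, 1} (\<lambda>x. ennreal (if x = 1 then r else 1 - r))"

definition walk_measure :: "(nat \<Rightarrow> real) \<Rightarrow> (nat \<Rightarrow> int) measure"
  where "walk_measure p = PiM UNIV (\<lambda>k. coin_law (p k))"

definition grad :: "(nat \<Rightarrow> real) \<Rightarrow> nat \<Rightarrow> ((nat \<Rightarrow> int) \<Rightarrow> real) \<Rightarrow> (nat \<Rightarrow> int) \<Rightarrow> real"
  where "grad p k F w = sqrt (p k * (1 - p k)) * (F (w(k := 1)) - F (w(k := -1)))"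

text \<open>The squared norm is extended-valued: the gradient of a square-integrable functional
  need not lie in \<open>\<ell>\<^sup>2\<close> at every sample point.\<close>

definition l2_norm_sq :: "(nat \<Rightarrow> real) \<Rightarrow> ennreal"
  where "l2_norm_sq a = (\<Sum>k. ennreal ((a k)\<^sup>2))"

text \<open>Elements of \<open>L\<^sup>2\<close> are represented by measurable functions rather than by classes modulo
  null sets. Changing \<open>F\<close> on a null set changes each \<open>grad p k F\<close> only on a null set,
  because both values of every coordinate have positive probability.\<close>

definition Dom :: "(nat \<Rightarrow> real) \<Rightarrow> ((nat \<Rightarrow> int) \<Rightarrow> real) set"
  where "Dom p = {F \<in> borel_measurable (walk_measure p).
     integrable (walk_measure p) (\<lambda>w. (F w)\<^sup>2) \<and>
     (\<integral>\<^sup>+ w. l2_norm_sq (\<lambda>k. grad p k F w) \<partial>walk_measure p) < \<infinity>}"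

definition Ent :: "'a measure \<Rightarrow> ('a \<Rightarrow> real) \<Rightarrow> real"
  where "Ent M F = (\<integral>w. F w * ln (F w) \<partial>M) - (\<integral>w. F w \<partial>M) * ln (\<integral>w. F w \<partial>M)"

lemma space_walk_measure: "space (walk_measure p) = Omega"
  by (simp add: walk_measure_def Omega_def coin_law_def space_PiM space_point_measure)

lemma prob_space_coin_law:
  assumes "0 < r" "r < 1"
  shows "prob_space (coin_law r)"
proof
  show "emeasure (coin_law r) (space (coin_law r)) = 1"
    using assms
    by (simp add: coin_law_def space_point_measure emeasure_point_measure_finite
        flip: ennreal_plus)
qed

lemma
  assumes p: "\<And>k. 0 < p k \<and> p k < 1"
  shows prob_space_walk_measure: "prob_space (walk_measure p)"
    and walk_measure_coordinate: "measure (walk_measure p) {w \<in> Omega. w k = 1} = p k"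
    and indep_vars_coordinates:
      "prob_space.indep_vars (walk_measure p) (\<lambda>k. coin_law (p k)) (\<lambda>k w. w k) UNIV"
proof -
  interpret product_prob_space "\<lambda>k. coin_law (p k)" UNIV
    using p prob_space_coin_law
    by (auto simp: product_prob_space_def product_prob_space_axioms_def product_sigma_finite_def
        intro: prob_space_imp_sigma_finite)
  show P: "prob_space (walk_measure p)"
    unfolding walk_measure_def by (rule prob_space_axioms)
  have "{w \<in> Omega. w k = 1} =
      prod_emb UNIV (\<lambda>k. coin_law (p k)) {k} (\<Pi>\<^sub>E j\<in>{k}. {1})"
    by (auto simp: prod_emb_def Omega_def coin_law_def space_point_measure PiE_iff
        restrict_def fun_eq_iff split: if_splits)
  then have "measure (walk_measure p) {w \<in> Omega. w k = 1} = measure (coin_law (p k)) {1}"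
    using measure_PiM_emb[of "{k}" "\<lambda>_. {1}"]
    by (simp add: walk_measure_def coin_law_def sets_point_measure)
  then show "measure (walk_measure p) {w \<in> Omega. w k = 1} = p k"
    using p[of k] by (simp add: coin_law_def measure_def emeasure_point_measure_finite)
  have "distr (PiM UNIV (\<lambda>k. coin_law (p k))) (PiM UNIV (\<lambda>k. coin_law (p k))) (\<lambda>w. \<lambda>k\<in>UNIV. w k)
      = PiM UNIV (\<lambda>k. coin_law (p k))"
    by (simp add: restrict_UNIV distr_id2)
  moreover have "distr (PiM UNIV (\<lambda>k. coin_law (p k))) (coin_law (p k)) (\<lambda>w. w k) = coin_law (p k)" for k
    by (rule PiM_component) simp
  ultimately show "prob_space.indep_vars (walk_measure p) (\<lambda>k. coin_law (p k)) (\<lambda>k w. w k) UNIV"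
    unfolding walk_measure_def
    by (subst indep_vars_iff_distr_eq_PiM) auto
qed

end

theory Submission
  imports Defs
begin

text \<open>Let \<open>A\<^sub>k\<close> (\<open>avg p k\<close>) integrate out the \<open>k\<close>-th coordinate and let
  \<open>S\<^sub>n = A\<^sub>n\<^sub>-\<^sub>1 \<dots> A\<^sub>0\<close>. From \<open>ln x \<le> x - 1\<close> one gets
  \<open>E[f ln f] \<le> E[A\<^sub>k f ln (A\<^sub>k f)] + E[(D\<^sub>k f)\<^sup>2 / f]\<close>. Since \<open>A\<^sub>j\<close> commutes with \<open>D\<^sub>k\<close> for
  \<open>j \<noteq> k\<close> and \<open>(x, a) \<mapsto> x\<^sup>2 / a\<close> is convex, \<open>A\<^sub>j\<close> does not increase
  \<open>E[(D\<^sub>k f)\<^sup>2 / f]\<close>, so the one-coordinate estimates for \<open>F, S\<^sub>1 F, S\<^sub>2 F, \<dots>\<close> telescope.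
  The remainder \<open>Ent[S\<^sub>n F]\<close> is at most \<open>Var(S\<^sub>n F) / E[F]\<close>, which tends to \<open>0\<close>: it vanishes
  eventually for cylinder functions, these are dense in \<open>L\<^sup>2\<close>, and \<open>S\<^sub>n\<close> is a contraction of
  \<open>L\<^sup>2\<close>.\<close>

section \<open>Coordinate averages and energies\<close>

definition avg :: "(nat \<Rightarrow> real) \<Rightarrow> nat \<Rightarrow> ((nat \<Rightarrow> int) \<Rightarrow> real) \<Rightarrow> (nat \<Rightarrow> int) \<Rightarrow> real"
  where "avg p k f w = p k * f (w(k := 1)) + (1 - p k) * f (w(k := -1))"

primrec avgs :: "(nat \<Rightarrow> real) \<Rightarrow> nat \<Rightarrow> ((nat \<Rightarrow> int) \<Rightarrow> real) \<Rightarrow> (nat \<Rightarrow> int) \<Rightarrow> real"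
  where
    "avgs p 0 f = f"
  | "avgs p (Suc n) f = avg p n (avgs p n f)"

text \<open>A Bochner integral, with value 0 by default for a non-integrable integrand. The
  estimates apply it to square-integrable \<open>f\<close> bounded below by a positive constant,
  where \<open>integrable_square_divide\<close> gives integrability.\<close>

definition energy :: "(nat \<Rightarrow> real) \<Rightarrow> nat \<Rightarrow> ((nat \<Rightarrow> int) \<Rightarrow> real) \<Rightarrow> real"
  where "energy p k f = (\<integral>w. (grad p k f w)\<^sup>2 / f w \<partial>walk_measure p)"

section \<open>Scalar and two-point inequalities\<close>

text \<open>Concavity of \<open>ln\<close> at \<open>m\<close>, multiplied by \<open>x\<close>.
  Since \<open>x * (x / m - 1) = (x - m) + (x - m)^2 / m\<close>, averaging this bound at the mean
  \<open>m\<close> leaves the variance divided by \<open>m\<close>.\<close>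

lemma x_ln_x_le_tangent:
  fixes x m :: real
  assumes "0 < x" "0 < m"
  shows "x * ln x \<le> x * ln m + x * (x / m - 1)"
proof -
  have "ln (x / m) \<le> x / m - 1"
    using assms by (intro ln_le_minus_one) simp
  then have "ln x \<le> ln m + (x / m - 1)"
    using assms by (simp add: ln_div)
  then have "x * ln x \<le> x * (ln m + (x / m - 1))"
    using assms by (intro mult_left_mono) auto
  then show ?thesis
    by (simp add: algebra_simps)
qed

lemma abs_x_ln_x_le:
  fixes x :: real
  assumes "0 < x"
  shows "\<bar>x * ln x\<bar> \<le> 1 + x\<^sup>2"
proof -
  have "x * ln x \<le> x\<^sup>2 - x"
    using x_ln_x_le_tangent[of x 1] assms by (simp add: algebra_simps power2_eq_square)
  moreover have "- (x * ln x) \<le> 1 - x"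
  proof -
    have "x * ln (1 / x) \<le> x * (1 / x - 1)"
      using assms by (intro mult_left_mono ln_le_minus_one) auto
    then show ?thesis
      using assms by (simp add: ln_div right_diff_distrib)
  qed
  ultimately show ?thesis
    using assms zero_le_power2[of x] by linarith
qed

text \<open>The tangent bound at the mean \<open>m\<close> is averaged over the two points. What
  remains is the variance of the two-point law, \<open>r * (1 - r) * (a - b)^2\<close>, which is the
  square of \<open>grad\<close> in one coordinate.\<close>

lemma two_point_entropy_le:
  fixes r a b :: real
  assumes "0 < r" "r < 1" "0 < a" "0 < b"
  defines "m \<equiv> r * a + (1 - r) * b"
  shows "r * (a * ln a) + (1 - r) * (b * ln b) \<le> m * ln m + r * (1 - r) * (a - b)\<^sup>2 / m"
proof -
  have m: "0 < m"
    using assms by (auto simp: m_def intro!: add_pos_pos)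
  have "r * (a * ln a) + (1 - r) * (b * ln b)
      \<le> r * (a * ln m + a * (a / m - 1)) + (1 - r) * (b * ln m + b * (b / m - 1))"
    using assms m by (intro add_mono mult_left_mono x_ln_x_le_tangent) auto
  also have "\<dots> = m * ln m + (r * a\<^sup>2 + (1 - r) * b\<^sup>2 - m * m) / m"
  proof -
    have "r * (a * (a / m - 1)) + (1 - r) * (b * (b / m - 1)) = (r * a\<^sup>2 + (1 - r) * b\<^sup>2) / m - m"
    proof -
      have "t * (t / m - 1) = t\<^sup>2 / m - t" for t
        by (simp add: power2_eq_square right_diff_distrib)
      then show ?thesis
        by (simp add: add_divide_distrib m_def[symmetric]) (simp add: m_def algebra_simps)
    qed
    moreover have "r * (a * ln m) + (1 - r) * (b * ln m) = m * ln m"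
      by (simp add: m_def algebra_simps)
    ultimately show ?thesis
      using m by (simp add: diff_divide_distrib) (simp add: algebra_simps)
  qed
  also have "r * a\<^sup>2 + (1 - r) * b\<^sup>2 - m * m = r * (1 - r) * (a - b)\<^sup>2"
    by (simp add: m_def algebra_simps power2_eq_square)
  finally show ?thesis .
qed

text \<open>Joint convexity of \<open>x^2 / a\<close> in \<open>(x, a)\<close> for
  \<open>a > 0\<close>: after clearing the denominator on the left, the difference of the two sides
  is a nonnegative multiple of a square.\<close>

lemma two_point_square_over_linear:
  fixes r a b x y :: real
  assumes "0 < r" "r < 1" "0 < a" "0 < b"
  shows "(r * x + (1 - r) * y)\<^sup>2 / (r * a + (1 - r) * b) \<le> r * (x\<^sup>2 / a) + (1 - r) * (y\<^sup>2 / b)"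
proof -
  have m: "0 < r * a + (1 - r) * b"
    using assms by (auto intro!: add_pos_pos)
  have "(r * (x\<^sup>2 / a) + (1 - r) * (y\<^sup>2 / b)) * (r * a + (1 - r) * b)
      - (r * x + (1 - r) * y)\<^sup>2 = r * (1 - r) * ((x * b - y * a)\<^sup>2 / (a * b))"
    using assms by (simp add: field_simps power2_eq_square)
  moreover have "0 \<le> r * (1 - r) * ((x * b - y * a)\<^sup>2 / (a * b))"
    using assms by simp
  ultimately show ?thesis
    using m by (simp add: pos_divide_le_eq)
qed

section \<open>Resampling one coordinate of the product measure\<close>

locale biased_walk =
  fixes p :: "nat \<Rightarrow> real"
  assumes p_bounds: "0 < p k \<and> p k < 1"
begin

abbreviation "M \<equiv> walk_measure p"

sublocale prob_space M
  using prob_space_walk_measure p_bounds by blast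

lemma measurable_update:
  assumes "v \<in> {-1, 1}"
  shows "(\<lambda>w. w(k := v)) \<in> measurable M M"
  unfolding walk_measure_def
  using assms by (intro measurable_fun_upd[where J = UNIV]) (auto simp: coin_law_def space_point_measure)

lemma update_in_Omega: "w \<in> Omega \<Longrightarrow> v \<in> {-1, 1} \<Longrightarrow> w(k := v) \<in> Omega"
  by (auto simp: Omega_def PiE_iff)

text \<open>Replacing coordinate \<open>k\<close> by an independent coin with the same law leaves
  \<open>M\<close> invariant, so \<open>M\<close> is the image of \<open>coin_law (p k)\<close>
  times \<open>M\<close> itself. Fubini and the two atoms of the coin give the formula.\<close>

lemma nn_integral_split_coordinate:
  assumes g [measurable]: "g \<in> borel_measurable M"
  shows "(\<integral>\<^sup>+w. g w \<partial>M) =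
    ennreal (p k) * (\<integral>\<^sup>+w. g (w(k := 1)) \<partial>M) + ennreal (1 - p k) * (\<integral>\<^sup>+w. g (w(k := -1)) \<partial>M)"
proof -
  let ?C = "coin_law (p k)"
  have upd: "(\<lambda>(x, X). X(k := x)) \<in> measurable (?C \<Otimes>\<^sub>M M) M"
    unfolding walk_measure_def case_prod_beta
    by (rule measurable_fun_upd[where J = UNIV]) auto
  have "M = distr (?C \<Otimes>\<^sub>M M) M (\<lambda>(x, X). X(k := x))"
    using distr_pair_PiM_eq_PiM[of UNIV "\<lambda>k. coin_law (p k)" k] prob_space_coin_law p_bounds
    by (simp add: walk_measure_def)
  then have "(\<integral>\<^sup>+w. g w \<partial>M) = (\<integral>\<^sup>+w. g w \<partial>distr (?C \<Otimes>\<^sub>M M) M (\<lambda>(x, X). X(k := x)))"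
    by (rule arg_cong[where f = "\<lambda>N. nn_integral N g"])
  also have "\<dots> = (\<integral>\<^sup>+z. g ((snd z)(k := fst z)) \<partial>(?C \<Otimes>\<^sub>M M))"
    using nn_integral_distr[OF upd, of g] by (simp add: split_beta')
  also have "\<dots> = (\<integral>\<^sup>+x. \<integral>\<^sup>+X. g (X(k := x)) \<partial>M \<partial>?C)"
    using nn_integral_fst[of "\<lambda>z. g ((snd z)(k := fst z))" ?C] measurable_compose[OF upd g]
    by (simp add: split_beta')
  also have "\<dots> = ennreal (p k) * (\<integral>\<^sup>+w. g (w(k := 1)) \<partial>M)
      + ennreal (1 - p k) * (\<integral>\<^sup>+w. g (w(k := -1)) \<partial>M)"
    unfolding coin_law_def
    by (subst nn_integral_point_measure_finite) (auto simp: mult.commute add.commute)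
  finally show ?thesis .
qed

text \<open>The measure of an exceptional null set splits into two nonnegative terms with positive
  weights, so the preimage of the null set under either update is null too.\<close>

lemma AE_update:
  assumes ae: "AE w in M. P w" and v: "v \<in> {-1, 1}"
  shows "AE w in M. P (w(k := v))"
proof -
  obtain N where N: "{w \<in> space M. \<not> P w} \<subseteq> N" "emeasure M N = 0" and [measurable]: "N \<in> sets M"
    using ae by (auto elim: AE_E)
  have [measurable]: "(\<lambda>w. w(k := v)) \<in> measurable M M"
    using v by (rule measurable_update)
  have "(\<integral>\<^sup>+w. indicator N w \<partial>M) = 0"
    using N by simp
  then have "(\<integral>\<^sup>+w. indicator N (w(k := v)) \<partial>M) = 0"
    using v p_bounds[of k] nn_integral_split_coordinate[of "indicator N" k] by auto
  then have "AE w in M. w \<in> space M \<and> indicator N (w(k := v)) = (0::ennreal)"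
    by (subst (asm) nn_integral_0_iff_AE) auto
  then show ?thesis
  proof (rule eventually_mono)
    fix w assume "w \<in> space M \<and> indicator N (w(k := v)) = (0::ennreal)"
    then show "P (w(k := v))"
      using N(1) update_in_Omega[of w v k] v
      by (auto simp: space_walk_measure indicator_def split: if_splits)
  qed
qed

lemma integrable_update:
  fixes f :: "(nat \<Rightarrow> int) \<Rightarrow> real"
  assumes f: "integrable M f" and v: "v \<in> {-1, 1}"
  shows "integrable M (\<lambda>w. f (w(k := v)))"
proof (rule integrableI_bounded)
  have [measurable]: "f \<in> borel_measurable M"
    using f by (rule borel_measurable_integrable)
  show "(\<lambda>w. f (w(k := v))) \<in> borel_measurable M"
    by (rule measurable_compose[OF measurable_update[OF v]]) measurable
  have "(\<integral>\<^sup>+w. norm (f w) \<partial>M) < \<infinity>"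
    using f by (simp add: integrable_iff_bounded)
  then show "(\<integral>\<^sup>+w. ennreal (norm (f (w(k := v)))) \<partial>M) < \<infinity>"
    using nn_integral_split_coordinate[of "\<lambda>w. ennreal (norm (f w))" k] v p_bounds[of k]
    by (auto simp: ennreal_mult_less_top)
qed

lemma integral_split_coordinate:
  assumes f: "integrable M f"
  shows "(\<integral>w. f w \<partial>M) = p k * (\<integral>w. f (w(k := 1)) \<partial>M) + (1 - p k) * (\<integral>w. f (w(k := -1)) \<partial>M)"
proof -
  have [measurable]: "f \<in> borel_measurable M"
    using f by auto
  have fin: "(\<integral>\<^sup>+w. ennreal (g w) \<partial>M) \<noteq> \<infinity>" "(\<integral>\<^sup>+w. ennreal (- g w) \<partial>M) \<noteq> \<infinity>" if "integrable M g" for g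
    using that by (simp_all add: real_integrable_def)
  have up: "integrable M (\<lambda>w. f (w(k := 1)))" and dn: "integrable M (\<lambda>w. f (w(k := -1)))"
    using f by (auto intro: integrable_update)
  \<comment> \<open>\<open>enn2real\<close> sends infinity to 0 and is additive only on finite
    values; finiteness comes from integrability of both updated functions.\<close>
  have "enn2real (a * x + b * y) = enn2real a * enn2real x + enn2real b * enn2real y"
    if "x \<noteq> \<infinity>" "y \<noteq> \<infinity>" "a \<noteq> \<infinity>" "b \<noteq> \<infinity>" for a b x y :: ennreal
    using that by (subst enn2real_plus) (auto simp: enn2real_mult ennreal_mult_less_top less_top)
  then show ?thesis
    using fin[OF up] fin[OF dn] p_bounds[of k]
    by (simp add: real_lebesgue_integral_def[OF f] real_lebesgue_integral_def[OF up]
        real_lebesgue_integral_def[OF dn] nn_integral_split_coordinate[of "\<lambda>w. ennreal (f w)" k]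
        nn_integral_split_coordinate[of "\<lambda>w. ennreal (- f w)" k] algebra_simps)
qed

lemma integrable_avg: "integrable M f \<Longrightarrow> integrable M (avg p k f)"
  unfolding avg_def by (intro Bochner_Integration.integrable_add integrable_mult_right integrable_update) auto

lemma integral_avg:
  assumes f: "integrable M f"
  shows "(\<integral>w. avg p k f w \<partial>M) = (\<integral>w. f w \<partial>M)"
  unfolding avg_def
  using f by (subst Bochner_Integration.integral_add) (auto intro!: integrable_update simp: integral_split_coordinate[of f k])

section \<open>Square-integrable functionals and their averages\<close>

definition L2 :: "((nat \<Rightarrow> int) \<Rightarrow> real) \<Rightarrow> bool"
  where "L2 f \<longleftrightarrow> f \<in> borel_measurable M \<and> integrable M (\<lambda>w. (f w)\<^sup>2)"

lemma L2_measurable: "L2 f \<Longrightarrow> f \<in> borel_measurable M"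
  by (simp add: L2_def)

lemma L2_integrable_square: "L2 f \<Longrightarrow> integrable M (\<lambda>w. (f w)\<^sup>2)"
  by (simp add: L2_def)

lemma L2_integrable: "L2 f \<Longrightarrow> integrable M f"
  unfolding L2_def by (auto intro: square_integrable_imp_integrable)

lemma L2_dominated:
  assumes "g \<in> borel_measurable M" "L2 f" "\<And>w. w \<in> Omega \<Longrightarrow> \<bar>g w\<bar> \<le> \<bar>f w\<bar>"
  shows "L2 g"
  using assms unfolding L2_def
  by (auto intro!: Bochner_Integration.integrable_bound[of M "\<lambda>w. (f w)\<^sup>2" "\<lambda>w. (g w)\<^sup>2"]
      simp: space_walk_measure abs_le_square_iff)

lemma L2_const [simp]: "L2 (\<lambda>w. c)"
  by (simp add: L2_def)

lemma L2_scale: "L2 f \<Longrightarrow> L2 (\<lambda>w. c * f w)"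
  by (auto simp: L2_def power_mult_distrib)

lemma L2_add:
  assumes "L2 f" "L2 g"
  shows "L2 (\<lambda>w. f w + g w)"
proof -
  have [measurable]: "f \<in> borel_measurable M" "g \<in> borel_measurable M"
    using assms by (simp_all add: L2_def)
  have "integrable M (\<lambda>w. (f w + g w)\<^sup>2)"
  proof (rule Bochner_Integration.integrable_bound)
    show "integrable M (\<lambda>w. 2 * (f w)\<^sup>2 + 2 * (g w)\<^sup>2)"
      using assms by (auto simp: L2_def)
    have "(x + y)\<^sup>2 \<le> 2 * x\<^sup>2 + 2 * y\<^sup>2" for x y :: real
      using zero_le_power2[of "x - y"] by (simp add: power2_sum power2_diff)
    then show "AE w in M. norm ((f w + g w)\<^sup>2) \<le> norm (2 * (f w)\<^sup>2 + 2 * (g w)\<^sup>2)"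
      by simp
  qed measurable
  then show ?thesis
    by (simp add: L2_def)
qed

lemma L2_diff: "L2 f \<Longrightarrow> L2 g \<Longrightarrow> L2 (\<lambda>w. f w - g w)"
  using L2_add[of f "\<lambda>w. -1 * g w"] L2_scale[of g "-1"] by simp

lemma L2_update:
  assumes "L2 f" "v \<in> {-1, 1}"
  shows "L2 (\<lambda>w. f (w(k := v)))"
proof -
  have "(\<lambda>w. f (w(k := v))) \<in> borel_measurable M"
    using measurable_compose[OF measurable_update L2_measurable] assms by blast
  then show ?thesis
    using assms integrable_update[of "\<lambda>w. (f w)\<^sup>2" v k] by (simp add: L2_def del: insert_iff)
qed

lemma L2_avg: "L2 f \<Longrightarrow> L2 (avg p k f)"
  unfolding avg_def by (intro L2_add L2_scale L2_update) auto

lemma L2_avgs: "L2 f \<Longrightarrow> L2 (avgs p n f)"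
  by (induction n) (auto intro: L2_avg)

lemma L2_grad: "L2 f \<Longrightarrow> L2 (grad p k f)"
  unfolding grad_def by (intro L2_diff L2_scale L2_update) auto

text \<open>Jensen's inequality for the square: the two-point convexity bound with both denominators
  equal to 1.\<close>

lemma square_avg_le: "(avg p k f w)\<^sup>2 \<le> avg p k (\<lambda>w. (f w)\<^sup>2) w"
  using two_point_square_over_linear[of "p k" 1 1 "f (w(k := 1))" "f (w(k := -1))"] p_bounds[of k]
  by (simp add: avg_def)

lemma integral_square_avg_le:
  assumes "L2 f"
  shows "(\<integral>w. (avg p k f w)\<^sup>2 \<partial>M) \<le> (\<integral>w. (f w)\<^sup>2 \<partial>M)"
proof -
  have "(\<integral>w. (avg p k f w)\<^sup>2 \<partial>M) \<le> (\<integral>w. avg p k (\<lambda>w. (f w)\<^sup>2) w \<partial>M)"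
    using assms
    by (intro integral_mono L2_integrable_square L2_avg integrable_avg square_avg_le)
  also have "\<dots> = (\<integral>w. (f w)\<^sup>2 \<partial>M)"
    using assms by (intro integral_avg L2_integrable_square)
  finally show ?thesis .
qed

lemma integral_square_avgs_le:
  assumes "L2 f"
  shows "(\<integral>w. (avgs p n f w)\<^sup>2 \<partial>M) \<le> (\<integral>w. (f w)\<^sup>2 \<partial>M)"
proof (induction n)
  case (Suc n)
  then show ?case
    using integral_square_avg_le[OF L2_avgs[OF assms], of n n] by simp
qed simp

lemma integral_avgs: "L2 f \<Longrightarrow> (\<integral>w. avgs p n f w \<partial>M) = (\<integral>w. f w \<partial>M)"
  by (induction n) (auto simp: integral_avg L2_integrable L2_avgs)

text \<open>Averages are convex combinations; negation turns the upper bound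
  \<open>convex_bound_le\<close> into a lower one. The positive constant \<open>c\<close> thus
  survives all averaging steps and keeps logarithms and quotients under control.\<close>

lemma avg_ge: "(\<And>w. c \<le> f w) \<Longrightarrow> c \<le> avg p k f w"
  using p_bounds[of k] convex_bound_le[of "- f (w(k := 1))" "-c" "- f (w(k := -1))" "p k" "1 - p k"]
  by (simp add: avg_def)

lemma avgs_ge: "(\<And>w. c \<le> f w) \<Longrightarrow> c \<le> avgs p n f w"
  by (induction n arbitrary: w) (auto intro: avg_ge)

lemma integrable_square_divide:
  assumes "L2 g" and [measurable]: "h \<in> borel_measurable M" and "0 < c" "\<And>w. c \<le> h w"
  shows "integrable M (\<lambda>w. (g w)\<^sup>2 / h w)"
proof (rule Bochner_Integration.integrable_bound)
  show "integrable M (\<lambda>w. (g w)\<^sup>2 / c)"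
    using assms by (simp add: L2_integrable_square)
  show "(\<lambda>w. (g w)\<^sup>2 / h w) \<in> borel_measurable M"
    using L2_measurable[OF assms(1)] by measurable
  have "0 < h w" for w
    using assms(3) assms(4)[of w] by linarith
  then show "AE w in M. norm ((g w)\<^sup>2 / h w) \<le> norm ((g w)\<^sup>2 / c)"
    using assms(3,4) by (auto intro!: divide_left_mono mult_pos_pos simp: abs_of_pos)
qed

text \<open>\<open>abs_x_ln_x_le\<close> supplies the integrable majorant \<open>1 + f^2\<close>,
  valid for small and large values of \<open>f\<close> alike.\<close>

lemma integrable_x_ln_x:
  assumes f: "L2 f" and "\<And>w. 0 < f w"
  shows "integrable M (\<lambda>w. f w * ln (f w))"
proof (rule Bochner_Integration.integrable_bound)
  show "integrable M (\<lambda>w. 1 + (f w)\<^sup>2)"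
    using f by (simp add: L2_integrable_square)
  show "(\<lambda>w. f w * ln (f w)) \<in> borel_measurable M"
    using L2_measurable[OF f] by measurable
  show "AE w in M. norm (f w * ln (f w)) \<le> norm (1 + (f w)\<^sup>2)"
    using abs_x_ln_x_le assms(2) by auto
qed

section \<open>One-coordinate entropy estimate and telescoping\<close>

lemma grad_update_same: "grad p k f (w(k := v)) = grad p k f w"
  by (simp add: grad_def)

lemma grad_avg:
  assumes "j \<noteq> k"
  shows "grad p k (avg p j f) w = avg p j (grad p k f) w"
  using assms by (simp add: grad_def avg_def fun_upd_twist algebra_simps)

lemma grad_square: "(grad p k f w)\<^sup>2 = p k * (1 - p k) * (f (w(k := 1)) - f (w(k := -1)))\<^sup>2"
  using p_bounds[of k] by (simp add: grad_def power_mult_distrib)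

text \<open>For \<open>j \<noteq> k\<close> both the gradient and the denominator become averages
  over coordinate \<open>j\<close>. Joint convexity bounds the new integrand by the average of the
  old one, and averaging preserves integrals.\<close>

lemma energy_avg_le:
  assumes "j \<noteq> k" "L2 f" "0 < c" "\<And>w. c \<le> f w"
  shows "energy p k (avg p j f) \<le> energy p k f"
proof -
  let ?g = "\<lambda>w. (grad p k f w)\<^sup>2 / f w"
  have g: "integrable M ?g"
    using assms by (intro integrable_square_divide[of _ _ c] L2_grad L2_measurable) auto
  have pos: "0 < f w" for w
    using assms(3) assms(4)[of w] by linarith
  have "energy p k (avg p j f) \<le> (\<integral>w. avg p j ?g w \<partial>M)"
    unfolding energy_def
  proof (rule integral_mono)
    show "integrable M (\<lambda>w. (grad p k (avg p j f) w)\<^sup>2 / avg p j f w)"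
      using assms
      by (intro integrable_square_divide[of _ _ c] L2_grad L2_avg L2_measurable avg_ge) auto
    show "(grad p k (avg p j f) w)\<^sup>2 / avg p j f w \<le> avg p j ?g w" for w
      unfolding grad_avg[OF assms(1)] unfolding avg_def
      using pos p_bounds[of j] by (intro two_point_square_over_linear) auto
  qed (rule integrable_avg[OF g])
  also have "\<dots> = energy p k f"
    unfolding energy_def by (rule integral_avg[OF g])
  finally show ?thesis .
qed

text \<open>The two-point entropy bound yields a remainder with denominator
  \<open>avg p k f\<close>; a second use of convexity exchanges this denominator for
  \<open>f\<close>.\<close>

lemma integral_x_ln_x_avg:
  assumes "L2 f" "0 < c" "\<And>w. c \<le> f w"
  shows "(\<integral>w. f w * ln (f w) \<partial>M) \<le> (\<integral>w. avg p k f w * ln (avg p k f w) \<partial>M) + energy p k f"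
proof -
  let ?g = "\<lambda>w. (grad p k f w)\<^sup>2 / f w"
  let ?h = "\<lambda>w. (grad p k f w)\<^sup>2 / avg p k f w"
  have g: "integrable M ?g"
    using assms by (intro integrable_square_divide[of _ _ c] L2_grad L2_measurable) auto
  have h: "integrable M ?h"
    using assms by (intro integrable_square_divide[of _ _ c] L2_grad L2_avg L2_measurable avg_ge) auto
  have pos: "0 < f w" for w
    using assms(2) assms(3)[of w] by linarith
  have pos': "0 < avg p k f w" for w
    using assms(2) avg_ge[of c f k w] assms(3) by force
  have i: "integrable M (\<lambda>w. f w * ln (f w))"
    using assms(1) pos by (rule integrable_x_ln_x)
  have i': "integrable M (\<lambda>w. avg p k f w * ln (avg p k f w))"
    using L2_avg[OF assms(1)] pos' by (rule integrable_x_ln_x)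
  have "(\<integral>w. f w * ln (f w) \<partial>M) = (\<integral>w. avg p k (\<lambda>w. f w * ln (f w)) w \<partial>M)"
    by (rule integral_avg[OF i, symmetric])
  also have "\<dots> \<le> (\<integral>w. avg p k f w * ln (avg p k f w) + ?h w \<partial>M)"
  proof (rule integral_mono)
    show "avg p k (\<lambda>w. f w * ln (f w)) w \<le> avg p k f w * ln (avg p k f w) + ?h w" for w
      unfolding grad_square unfolding avg_def
      using pos p_bounds[of k] by (intro two_point_entropy_le) auto
  qed (use i' h integrable_avg[OF i] in auto)
  also have "\<dots> = (\<integral>w. avg p k f w * ln (avg p k f w) \<partial>M) + (\<integral>w. ?h w \<partial>M)"
    by (rule Bochner_Integration.integral_add[OF i' h])
  also have "(\<integral>w. ?h w \<partial>M) \<le> (\<integral>w. avg p k ?g w \<partial>M)"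
  proof (rule integral_mono[OF h integrable_avg[OF g]])
    fix w
    \<comment> \<open>The gradient in direction \<open>k\<close> is constant in coordinate
      \<open>k\<close>, hence equal to its own average. Written this way, the quotient fits the
      convexity bound with equal numerators.\<close>
    have "?h w = (p k * grad p k f w + (1 - p k) * grad p k f w)\<^sup>2
        / (p k * f (w(k := 1)) + (1 - p k) * f (w(k := -1)))"
      by (simp add: avg_def algebra_simps)
    also have "\<dots> \<le> avg p k ?g w"
      unfolding avg_def grad_update_same
      using pos p_bounds[of k] by (intro two_point_square_over_linear) auto
    finally show "?h w \<le> avg p k ?g w" .
  qed
  also have "(\<integral>w. avg p k ?g w \<partial>M) = energy p k f"
    unfolding energy_def by (rule integral_avg[OF g])
  finally show ?thesis
    by simp
qed

text \<open>\<open>avgs p n\<close> averages the coordinates below \<open>n\<close> only, all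
  different from \<open>k\<close>. The boundary case \<open>n = k\<close> is the one that the
  telescoping uses.\<close>

lemma energy_avgs_le:
  assumes "L2 f" "0 < c" "\<And>w. c \<le> f w"
  shows "n \<le> k \<Longrightarrow> energy p k (avgs p n f) \<le> energy p k f"
proof (induction n)
  case (Suc n)
  have "energy p k (avgs p (Suc n) f) \<le> energy p k (avgs p n f)"
    using energy_avg_le[of n k "avgs p n f" c] Suc.prems assms by (simp add: L2_avgs avgs_ge)
  with Suc show ?case
    by simp
qed simp

lemma integral_x_ln_x_avgs:
  assumes "L2 f" "0 < c" "\<And>w. c \<le> f w"
  shows "(\<integral>w. f w * ln (f w) \<partial>M)
    \<le> (\<integral>w. avgs p n f w * ln (avgs p n f w) \<partial>M) + (\<Sum>k<n. energy p k f)"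
proof (induction n)
  case (Suc n)
  have "(\<integral>w. avgs p n f w * ln (avgs p n f w) \<partial>M)
      \<le> (\<integral>w. avgs p (Suc n) f w * ln (avgs p (Suc n) f w) \<partial>M) + energy p n (avgs p n f)"
    using integral_x_ln_x_avg[of "avgs p n f" c n] assms by (simp add: L2_avgs avgs_ge)
  with Suc energy_avgs_le[OF assms, of n n] show ?case
    by simp
qed simp

text \<open>Entropy is at most variance over mean: the tangent bound is taken at the mean
  \<open>m\<close>, so its term \<open>f w - m\<close> integrates to 0.\<close>

lemma integral_x_ln_x_le:
  assumes "L2 f" "0 < c" "\<And>w. c \<le> f w"
  defines "m \<equiv> \<integral>w. f w \<partial>M"
  shows "(\<integral>w. f w * ln (f w) \<partial>M) \<le> m * ln m + (\<integral>w. (f w - m)\<^sup>2 \<partial>M) / m"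
proof -
  have f: "integrable M f" "integrable M (\<lambda>w. (f w - m)\<^sup>2)"
    using L2_integrable[OF assms(1)] L2_integrable_square[OF L2_diff[OF assms(1) L2_const]] by auto
  have pos: "0 < f w" for w
    using assms(2) assms(3)[of w] by linarith
  have "c = (\<integral>w. c \<partial>M)"
    by (simp add: prob_space)
  also have "\<dots> \<le> m"
    unfolding m_def using f assms(3) by (intro integral_mono) auto
  finally have m: "0 < m"
    using assms(2) by simp
  let ?r = "\<lambda>w. (f w * ln m + (f w - m)) + (f w - m)\<^sup>2 / m"
  have "(\<integral>w. f w * ln (f w) \<partial>M) \<le> (\<integral>w. ?r w \<partial>M)"
  proof (rule integral_mono)
    show "integrable M (\<lambda>w. f w * ln (f w))"
      using assms(1) pos by (rule integrable_x_ln_x)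
    show "integrable M ?r"
      using f by auto
    show "f w * ln (f w) \<le> ?r w" for w
    proof -
      have "f w * (f w / m - 1) = (f w - m) + (f w - m)\<^sup>2 / m"
        using m by (simp add: field_simps power2_eq_square)
      then show ?thesis
        using x_ln_x_le_tangent[OF pos[of w] m] by simp
    qed
  qed
  also have "\<dots> = m * ln m + (\<integral>w. (f w - m)\<^sup>2 \<partial>M) / m"
    using f by (simp add: prob_space m_def[symmetric])
  finally show ?thesis .
qed

section \<open>Convergence of the averages to the mean\<close>

text \<open>For square-integrable \<open>f\<close> this is the variance of
  \<open>avgs p n f\<close>, since averaging preserves the mean.\<close>

definition dev :: "nat \<Rightarrow> ((nat \<Rightarrow> int) \<Rightarrow> real) \<Rightarrow> real"
  where "dev n f = (\<integral>w. (avgs p n f w - (\<integral>v. f v \<partial>M))\<^sup>2 \<partial>M)"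

lemma dev_nonneg: "0 \<le> dev n f"
  unfolding dev_def by (rule integral_nonneg_AE) simp

lemma avgs_add: "avgs p n (\<lambda>w. f w + g w) w = avgs p n f w + avgs p n g w"
  by (induction n arbitrary: w) (auto simp: avg_def algebra_simps)

lemma avgs_scale: "avgs p n (\<lambda>w. c * f w) w = c * avgs p n f w"
  by (induction n arbitrary: w) (auto simp: avg_def algebra_simps)

lemma avgs_cong:
  assumes "\<And>w. w \<in> Omega \<Longrightarrow> f w = g w"
  shows "w \<in> Omega \<Longrightarrow> avgs p n f w = avgs p n g w"
  by (induction n arbitrary: w) (auto simp: avg_def assms update_in_Omega)

text \<open>Updates with values -1 and 1 stay inside \<open>Omega\<close>, so values of
  \<open>f\<close> elsewhere never enter. This lets indicators of complements relative to
  \<open>Omega\<close> be rewritten as \<open>1 - indicator A\<close>.\<close>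

lemma dev_cong:
  assumes "\<And>w. w \<in> Omega \<Longrightarrow> f w = g w"
  shows "dev n f = dev n g"
proof -
  have "(\<integral>v. f v \<partial>M) = (\<integral>v. g v \<partial>M)"
    using assms by (intro Bochner_Integration.integral_cong) (auto simp: space_walk_measure)
  then show ?thesis
    unfolding dev_def using avgs_cong[OF assms]
    by (intro Bochner_Integration.integral_cong) (auto simp: space_walk_measure)
qed

lemma L2_dev: "L2 f \<Longrightarrow> L2 (\<lambda>w. avgs p n f w - (\<integral>v. f v \<partial>M))"
  by (intro L2_diff L2_avgs L2_const)

lemma dev_add_le:
  assumes "L2 f" "L2 g"
  shows "dev n (\<lambda>w. f w + g w) \<le> 2 * dev n f + 2 * dev n g"
proof -
  let ?d = "\<lambda>f w. avgs p n f w - (\<integral>v. f v \<partial>M)"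
  have sq: "integrable M (\<lambda>w. (?d f w)\<^sup>2)" if "L2 f" for f
    using L2_integrable_square[OF L2_dev[OF that]] .
  have "dev n (\<lambda>w. f w + g w) \<le> (\<integral>w. 2 * (?d f w)\<^sup>2 + 2 * (?d g w)\<^sup>2 \<partial>M)"
    unfolding dev_def
  proof (rule integral_mono)
    show "integrable M (\<lambda>w. (?d (\<lambda>w. f w + g w) w)\<^sup>2)"
      using assms by (intro sq L2_add)
    show "integrable M (\<lambda>w. 2 * (?d f w)\<^sup>2 + 2 * (?d g w)\<^sup>2)"
      using sq[OF assms(1)] sq[OF assms(2)] by simp
    have "(x + y)\<^sup>2 \<le> 2 * x\<^sup>2 + 2 * y\<^sup>2" for x y :: real
      using zero_le_power2[of "x - y"] by (simp add: power2_sum power2_diff)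
    from this[of "?d f w" "?d g w" for w]
    show "(?d (\<lambda>w. f w + g w) w)\<^sup>2 \<le> 2 * (?d f w)\<^sup>2 + 2 * (?d g w)\<^sup>2" for w
      using assms by (simp add: avgs_add L2_integrable algebra_simps)
  qed
  also have "\<dots> = 2 * dev n f + 2 * dev n g"
    using sq[OF assms(1)] sq[OF assms(2)] by (simp add: dev_def)
  finally show ?thesis .
qed

lemma dev_scale: "dev n (\<lambda>w. c * f w) = c\<^sup>2 * dev n f"
  by (simp add: dev_def avgs_scale power_mult_distrib flip: right_diff_distrib)

text \<open>A variance is at most the second moment, and averaging contracts the second moment. The
  bound is uniform in \<open>n\<close>, as the approximation argument requires.\<close>

lemma dev_le:
  assumes "L2 f"
  shows "dev n f \<le> (\<integral>w. (f w)\<^sup>2 \<partial>M)"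
proof -
  let ?m = "\<integral>v. f v \<partial>M"
  have i: "integrable M (\<lambda>w. (avgs p n f w)\<^sup>2)" "integrable M (avgs p n f)"
    using assms by (auto intro: L2_integrable_square L2_integrable L2_avgs)
  have "dev n f = (\<integral>w. (avgs p n f w)\<^sup>2 - 2 * ?m * avgs p n f w + ?m\<^sup>2 \<partial>M)"
    unfolding dev_def by (intro Bochner_Integration.integral_cong) (auto simp: power2_diff)
  also have "\<dots> = (\<integral>w. (avgs p n f w)\<^sup>2 \<partial>M) - ?m\<^sup>2"
    using i integral_avgs[OF assms, of n] by (simp add: prob_space power2_eq_square)
  also have "\<dots> \<le> (\<integral>w. (f w)\<^sup>2 \<partial>M)"
    using integral_square_avgs_le[OF assms, of n] zero_le_power2[of ?m] by linarith
  finally show ?thesis .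
qed

lemma dev_tendsto_add:
  assumes "L2 f" "L2 g" "(\<lambda>n. dev n f) \<longlonglongrightarrow> 0" "(\<lambda>n. dev n g) \<longlonglongrightarrow> 0"
  shows "(\<lambda>n. dev n (\<lambda>w. f w + g w)) \<longlonglongrightarrow> 0"
proof (rule tendsto_sandwich[OF _ _ tendsto_const])
  show "(\<lambda>n. 2 * dev n f + 2 * dev n g) \<longlonglongrightarrow> 0"
    using tendsto_add[OF tendsto_mult_left[OF assms(3), of 2] tendsto_mult_left[OF assms(4), of 2]]
    by simp
qed (use assms in \<open>auto simp: dev_nonneg dev_add_le\<close>)

lemma dev_tendsto_scale:
  "(\<lambda>n. dev n f) \<longlonglongrightarrow> 0 \<Longrightarrow> (\<lambda>n. dev n (\<lambda>w. c * f w)) \<longlonglongrightarrow> 0"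
  using tendsto_mult_left[of "\<lambda>n. dev n f" 0 sequentially "c\<^sup>2"] by (simp add: dev_scale)

text \<open>The functionals with vanishing deviation are closed in the L2 norm, by the uniform bound
  \<open>dev_le\<close> on the approximation error.\<close>

lemma dev_tendsto_limit:
  assumes f: "L2 f" and u: "\<And>i. L2 (u i)" "\<And>i. (\<lambda>n. dev n (u i)) \<longlonglongrightarrow> 0"
    and lim: "(\<lambda>i. \<integral>w. (f w - u i w)\<^sup>2 \<partial>M) \<longlonglongrightarrow> 0"
  shows "(\<lambda>n. dev n f) \<longlonglongrightarrow> 0"
proof (rule LIMSEQ_I)
  fix e :: real assume e: "0 < e"
  \<comment> \<open>\<open>dev_add_le\<close> doubles each of the two contributions, hence
    \<open>e / 4\<close>.\<close>
  obtain i where i: "(\<integral>w. (f w - u i w)\<^sup>2 \<partial>M) < e / 4"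
    using LIMSEQ_D[OF lim, of "e / 4"] e by fastforce
  obtain N where N: "\<And>n. N \<le> n \<Longrightarrow> dev n (u i) < e / 4"
    using LIMSEQ_D[OF u(2)[of i], of "e / 4"] e by fastforce
  have "norm (dev n f - 0) < e" if "N \<le> n" for n
  proof -
    have d: "L2 (\<lambda>w. f w - u i w)"
      using f u by (intro L2_diff)
    have "dev n f \<le> 2 * dev n (u i) + 2 * dev n (\<lambda>w. f w - u i w)"
      using dev_add_le[OF u(1)[of i] d, of n] by simp
    with N[OF that] dev_le[OF d, of n] i dev_nonneg[of n f] show ?thesis
      by simp
  qed
  then show "\<exists>N. \<forall>n\<ge>N. norm (dev n f - 0) < e"
    by blast
qed

text \<open>Dominated convergence with majorant \<open>f^2\<close> upgrades pointwise convergence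
  from below to L2 convergence.\<close>

lemma dev_tendsto_dominated:
  assumes f: "L2 f" and u: "\<And>i. u i \<in> borel_measurable M" "\<And>i. (\<lambda>n. dev n (u i)) \<longlonglongrightarrow> 0"
    and bound: "\<And>i w. w \<in> Omega \<Longrightarrow> 0 \<le> u i w \<and> u i w \<le> f w"
    and lim: "\<And>w. w \<in> Omega \<Longrightarrow> (\<lambda>i. u i w) \<longlonglongrightarrow> f w"
  shows "(\<lambda>n. dev n f) \<longlonglongrightarrow> 0"
proof (rule dev_tendsto_limit[OF f])
  have [measurable]: "f \<in> borel_measurable M" "u i \<in> borel_measurable M" for i
    using u f by (auto simp: L2_def)
  show "L2 (u i)" for i
  proof (rule L2_dominated[OF _ f])
    show "\<bar>u i w\<bar> \<le> \<bar>f w\<bar>" if "w \<in> Omega" for w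
      using bound[OF that, of i] by simp
  qed measurable
  show "(\<lambda>i. \<integral>w. (f w - u i w)\<^sup>2 \<partial>M) \<longlonglongrightarrow> 0"
  proof -
    have "(\<lambda>i. \<integral>w. (f w - u i w)\<^sup>2 \<partial>M) \<longlonglongrightarrow> (\<integral>w. 0 \<partial>M)"
    proof (rule integral_dominated_convergence[where w = "\<lambda>w. (f w)\<^sup>2"])
      show "AE w in M. (\<lambda>i. (f w - u i w)\<^sup>2) \<longlonglongrightarrow> 0"
      proof (rule AE_I2)
        fix w assume "w \<in> space M"
        then have "(\<lambda>i. (f w - u i w)\<^sup>2) \<longlonglongrightarrow> (f w - f w)\<^sup>2"
          by (intro tendsto_intros lim) (simp add: space_walk_measure)
        then show "(\<lambda>i. (f w - u i w)\<^sup>2) \<longlonglongrightarrow> 0"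
          by simp
      qed
      show "AE w in M. norm ((f w - u i w)\<^sup>2) \<le> (f w)\<^sup>2" for i
      proof (rule AE_I2)
        fix w assume "w \<in> space M"
        then have "0 \<le> f w - u i w" "f w - u i w \<le> f w"
          using bound[of w i] by (auto simp: space_walk_measure)
        then show "norm ((f w - u i w)\<^sup>2) \<le> (f w)\<^sup>2"
          by (simp add: power_mono)
      qed
    qed (use L2_integrable_square[OF f] in auto)
    then show ?thesis
      by simp
  qed
qed (rule u(2))

definition depends_on :: "nat set \<Rightarrow> ((nat \<Rightarrow> int) \<Rightarrow> real) \<Rightarrow> bool"
  where "depends_on J f \<longleftrightarrow> (\<forall>w\<in>Omega. \<forall>v\<in>Omega. (\<forall>j\<in>J. w j = v j) \<longrightarrow> f w = f v)"

lemma depends_on_avg: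
  assumes "depends_on J f"
  shows "depends_on (J - {k}) (avg p k f)"
  unfolding depends_on_def
proof safe
  fix w v assume w: "w \<in> Omega" "v \<in> Omega" and eq: "\<forall>j\<in>J - {k}. w j = v j"
  have "f (w(k := x)) = f (v(k := x))" if "x \<in> {-1, 1}" for x
    using assms update_in_Omega[OF w(1) that] update_in_Omega[OF w(2) that] eq
    unfolding depends_on_def by (auto split: if_splits)
  then show "avg p k f w = avg p k f v"
    by (simp add: avg_def)
qed

lemma depends_on_avgs: "depends_on J f \<Longrightarrow> depends_on (J - {..<n}) (avgs p n f)"
proof (induction n)
  case (Suc n)
  have "J - {..<Suc n} = (J - {..<n}) - {n}"
    by auto
  with depends_on_avg[OF Suc.IH[OF Suc.prems], of n] show ?case
    by simp
qed simp

text \<open>Once every coordinate in \<open>J\<close> has been averaged, the result is constant on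
  \<open>Omega\<close>, and preservation of the mean identifies the constant.\<close>

lemma dev_eq_0:
  assumes f: "L2 f" "depends_on J f" and n: "J \<subseteq> {..<n}"
  shows "dev n f = 0"
proof -
  \<comment> \<open>The all-ones path is just a convenient point of \<open>Omega\<close> at which to
    read off the constant.\<close>
  define c where "c = avgs p n f (\<lambda>_. 1)"
  have "J - {..<n} = {}"
    using n by auto
  with depends_on_avgs[OF f(2), of n] have dep: "depends_on {} (avgs p n f)"
    by simp
  have "(\<lambda>_. 1) \<in> Omega"
    by (simp add: Omega_def PiE_iff)
  then have c: "avgs p n f w = c" if "w \<in> Omega" for w
    using dep that unfolding depends_on_def c_def by blast
  have "(\<integral>w. f w \<partial>M) = (\<integral>w. avgs p n f w \<partial>M)"
    using integral_avgs[OF f(1)] by simp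
  also have "\<dots> = (\<integral>w. c \<partial>M)"
    by (rule Bochner_Integration.integral_cong) (auto simp: c space_walk_measure)
  finally have "(\<integral>w. f w \<partial>M) = c"
    by (simp add: prob_space)
  then have "dev n f = (\<integral>w. 0 \<partial>M)"
    unfolding dev_def
    by (intro Bochner_Integration.integral_cong) (auto simp: c space_walk_measure)
  then show ?thesis
    by simp
qed

lemma L2_indicator: "A \<in> sets M \<Longrightarrow> L2 (indicator A)"
  by (rule L2_dominated[OF _ L2_const[of 1]]) (auto simp: indicator_def)

text \<open>Dynkin's pi-lambda argument: cylinder sets form an intersection-stable generator and
  depend on finitely many coordinates, so their deviation is eventually 0. The property passes to
  complements and countable disjoint unions.\<close>

lemma dev_tendsto_indicator:
  assumes "A \<in> sets M"
  shows "(\<lambda>n. dev n (indicator A)) \<longlonglongrightarrow> 0"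
proof -
  let ?C = "\<lambda>k. coin_law (p k)"
  let ?S = "\<Pi>\<^sub>E i\<in>UNIV. space (?C i)"
  have S: "?S = space M" "space M = Omega"
    by (simp add: walk_measure_def space_PiM) (rule space_walk_measure)
  have sets_M: "sets M = sigma_sets ?S (prod_algebra UNIV ?C)"
    unfolding walk_measure_def by (rule sets_PiM)
  show ?thesis
    using Int_stable_prod_algebra prod_algebra_sets_into_space assms[unfolded sets_M]
  proof (induction rule: sigma_sets_induct_disjoint)
    case (basic A)
    then obtain J E where A: "A = prod_emb UNIV ?C J (\<Pi>\<^sub>E j\<in>J. E j)" and J: "finite J"
      by (elim prod_algebraE)
    have "A \<in> sets M"
      unfolding sets_M using basic by (rule sigma_sets.Basic)
    moreover have "depends_on J (indicator A)"
      unfolding depends_on_def A S(2)[symmetric] S(1)[symmetric]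
      by (auto simp: prod_emb_def indicator_def PiE_iff)
    moreover obtain N where "J \<subseteq> {..<N}"
      using finite_nat_bounded[OF J] by blast
    ultimately have "dev n (indicator A) = 0" if "N \<le> n" for n
      using that by (intro dev_eq_0 L2_indicator) auto
    then show ?case
      by (intro tendsto_eventually eventually_sequentiallyI[of N])
  next
    case empty
    show ?case
      using dev_scale[of _ 0 "\<lambda>_. 0"] by (simp add: indicator_def)
  next
    case (compl A)
    then have A: "A \<in> sets M"
      by (simp add: sets_M)
    have "dev n (\<lambda>w. 1) = 0" for n
      by (rule dev_eq_0[of _ "{}"]) (auto simp: depends_on_def)
    then have "(\<lambda>n. dev n (\<lambda>w. 1 + (-1) * indicator A w)) \<longlonglongrightarrow> 0"
      using A by (intro dev_tendsto_add dev_tendsto_scale compl L2_scale L2_indicator) auto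
    moreover have "dev n (indicator (?S - A)) = dev n (\<lambda>w. 1 + (-1) * indicator A w)" for n
      unfolding S by (rule dev_cong) (simp add: indicator_def)
    ultimately show ?case
      by simp
  next
    case (union B)
    then have B: "B i \<in> sets M" for i
      by (auto simp: sets_M)
    let ?u = "\<lambda>i. indicator (\<Union>j<i. B j) :: (nat \<Rightarrow> int) \<Rightarrow> real"
    \<comment> \<open>Disjointness makes the indicators of the partial unions additive, which
      reduces them to \<open>dev_tendsto_add\<close>.\<close>
    have u_Suc: "?u (Suc i) = (\<lambda>w. ?u i w + indicator (B i) w)" for i
    proof -
      have "B j \<inter> B i = {}" if "j < i" for j
        using union.hyps(1) that by (simp add: disjoint_family_on_def)
      then have "(\<Union>j<i. B j) \<inter> B i = {}"
        by blast
      then show ?thesis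
        by (auto simp: fun_eq_iff indicator_def lessThan_Suc)
    qed
    have L2u: "L2 (?u i)" for i
      using B by (intro L2_indicator) auto
    show ?case
    proof (rule dev_tendsto_dominated[where u = ?u])
      show "L2 (indicator (\<Union>i. B i))"
        using B by (intro L2_indicator) auto
      show "?u i \<in> borel_measurable M" for i
        using L2u by (rule L2_measurable)
      show "(\<lambda>n. dev n (?u i)) \<longlonglongrightarrow> 0" for i
      proof (induction i)
        case 0
        then show ?case
          using dev_scale[of _ 0 "\<lambda>_. 0"] by (simp add: indicator_def)
      next
        case (Suc i)
        then show ?case
          unfolding u_Suc by (intro dev_tendsto_add L2u L2_indicator B union.IH)
      qed
      show "0 \<le> ?u i w \<and> ?u i w \<le> indicator (\<Union>i. B i) w" for i w
        by (auto simp: indicator_def)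
      show "(\<lambda>i. ?u i w) \<longlonglongrightarrow> indicator (\<Union>i. B i) w" for w
        by (rule LIMSEQ_indicator_UN)
    qed
  qed
qed

lemma dev_tendsto_0:
  assumes "L2 f" "\<And>w. 0 \<le> f w"
  shows "(\<lambda>n. dev n f) \<longlonglongrightarrow> 0"
proof -
  have "f \<in> borel_measurable M"
    using assms(1) by (rule L2_measurable)
  \<comment> \<open>Square-integrability is kept as a premise inside the induction, since each case
    has to recover it for the building blocks from the assembled function.\<close>
  from this assms(2) have "L2 f \<longrightarrow> (\<lambda>n. dev n f) \<longlonglongrightarrow> 0"
  proof (induction rule: borel_measurable_induct_real)
    case (set A)
    then show ?case
      by (simp add: dev_tendsto_indicator)
  next
    case (mult u c)
    show ?case
    proof (cases "c = 0")
      case True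
      then show ?thesis
        using dev_scale[of _ 0 "\<lambda>_. 0"] by simp
    next
      case False
      then show ?thesis
        \<comment> \<open>For \<open>c \<noteq> 0\<close>, rescaling by \<open>1 / c\<close>
          recovers \<open>L2 u\<close>. For \<open>c = 0\<close> this is impossible, which is why
          that case is separate.\<close>
        using mult L2_scale[of "\<lambda>w. c * u w" "1 / c"] by (auto intro: dev_tendsto_scale)
    qed
  next
    case (add u v)
    show ?case
    proof
      assume L: "L2 (\<lambda>w. v w + u w)"
      have "L2 u" "L2 v"
        using add by (auto intro!: L2_dominated[OF _ L])
      then show "(\<lambda>n. dev n (\<lambda>w. v w + u w)) \<longlonglongrightarrow> 0"
        using add by (intro dev_tendsto_add) auto
    qed
  next
    case (seq U)
    show ?case
    proof
      assume L: "L2 f"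
      have le: "0 \<le> U i w \<and> U i w \<le> f w" if "w \<in> Omega" for i w
        using seq that
        by (auto intro!: incseq_le[of "\<lambda>i. U i w"] simp: space_walk_measure incseq_def le_fun_def)
      have "L2 (U i)" for i
      proof (rule L2_dominated[OF _ L])
        show "\<bar>U i w\<bar> \<le> \<bar>f w\<bar>" if "w \<in> Omega" for w
          using le[OF that, of i] by simp
      qed (rule seq(1))
      then show "(\<lambda>n. dev n f) \<longlonglongrightarrow> 0"
        using seq le by (intro dev_tendsto_dominated[OF L, of U]) (auto simp: space_walk_measure)
    qed
  qed
  with assms(1) show ?thesis
    by simp
qed

section \<open>Passage to the limit and the entropy inequality\<close>

text \<open>The telescoped estimate holds for every \<open>n\<close> with error
  \<open>dev n f\<close> divided by the mean; letting \<open>n\<close> tend to infinity removes the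
  error.\<close>

lemma Ent_le_sum_energy:
  assumes "L2 f" "0 < c" "\<And>w. c \<le> f w" and sum: "\<And>n. (\<Sum>k<n. energy p k f) \<le> r"
  shows "Ent M f \<le> r"
proof -
  let ?m = "\<integral>w. f w \<partial>M"
  have le: "Ent M f \<le> r + dev n f / ?m" for n
  proof -
    have "(\<integral>w. avgs p n f w * ln (avgs p n f w) \<partial>M) \<le> ?m * ln ?m + dev n f / ?m"
      using integral_x_ln_x_le[of "avgs p n f" c] assms
      by (simp add: L2_avgs avgs_ge integral_avgs dev_def)
    with integral_x_ln_x_avgs[OF assms(1-3), of n] sum[of n] show ?thesis
      by (simp add: Ent_def)
  qed
  have "0 \<le> f w" for w
    using assms(2) assms(3)[of w] by linarith
  then have "(\<lambda>n. r + dev n f / ?m) \<longlonglongrightarrow> r + 0 / ?m"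
    unfolding divide_inverse using assms(1) by (intro tendsto_intros dev_tendsto_0)
  then have "(\<lambda>n. r + dev n f / ?m) \<longlonglongrightarrow> r"
    by simp
  then show ?thesis
    using le by (intro LIMSEQ_le_const) auto
qed

text \<open>Monotone convergence exchanges the sum over coordinates with the integral, allowing the
  value infinity. Each single term is finite, so it agrees with the real-valued
  \<open>energy\<close>.\<close>

lemma nn_integral_eq_suminf_energy:
  assumes f: "L2 f" "0 < c" "\<And>w. c \<le> f w"
  shows "(\<integral>\<^sup>+w. ennreal (1 / f w) * l2_norm_sq (\<lambda>k. grad p k f w) \<partial>M) = (\<Sum>k. ennreal (energy p k f))"
proof -
  have [measurable]: "f \<in> borel_measurable M" "grad p k f \<in> borel_measurable M" for k
    using f(1) L2_grad by (auto intro: L2_measurable)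
  have pos: "0 < f w" for w
    using f(2) f(3)[of w] by linarith
  have "ennreal (1 / f w) * l2_norm_sq (\<lambda>k. grad p k f w) = (\<Sum>k. ennreal ((grad p k f w)\<^sup>2 / f w))" for w
    using pos[of w]
    by (simp add: l2_norm_sq_def ennreal_mult[symmetric] flip: ennreal_suminf_cmult)
  then have "(\<integral>\<^sup>+w. ennreal (1 / f w) * l2_norm_sq (\<lambda>k. grad p k f w) \<partial>M)
      = (\<Sum>k. \<integral>\<^sup>+w. ennreal ((grad p k f w)\<^sup>2 / f w) \<partial>M)"
    by (simp add: nn_integral_suminf)
  also have "(\<lambda>k. \<integral>\<^sup>+w. ennreal ((grad p k f w)\<^sup>2 / f w) \<partial>M) = (\<lambda>k. ennreal (energy p k f))"
    unfolding energy_def using f pos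
    by (intro ext nn_integral_eq_integral integrable_square_divide[of _ _ c] L2_grad)
      (simp_all add: less_imp_le[OF pos])
  finally show ?thesis .
qed

end

theorem theorem13p3:
  fixes p :: "nat \<Rightarrow> real" and F :: "(nat \<Rightarrow> int) \<Rightarrow> real" and \<eta> :: real
  assumes "\<And>k. 0 < p k \<and> p k < 1"
    and "F \<in> Dom p"
    and "\<eta> > 0"
    and "AE w in walk_measure p. F w > \<eta>"
  shows "ereal (Ent (walk_measure p) F)
    \<le> enn2ereal (\<integral>\<^sup>+ w. ennreal (1 / F w) * l2_norm_sq (\<lambda>k. grad p k F w) \<partial>walk_measure p)"
proof -
  interpret biased_walk p
    by standard (rule assms(1))
  \<comment> \<open>Averages evaluate the functional pointwise, so the almost sure bound is replaced
    by one that holds everywhere; \<open>G\<close> differs from \<open>F\<close> only on a null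
    set.\<close>
  define G where "G w = max (F w) \<eta>" for w
  have [measurable]: "F \<in> borel_measurable M"
    using assms(2) by (simp add: Dom_def)
  then have [measurable]: "G \<in> borel_measurable M"
    unfolding G_def by measurable
  have FG: "AE w in M. F w = G w"
    using assms(4) by eventually_elim (simp add: G_def)
  have G_ge: "\<eta> \<le> G w" for w
    by (simp add: G_def)
  have "integrable M (\<lambda>w. (F w)\<^sup>2) \<longleftrightarrow> integrable M (\<lambda>w. (G w)\<^sup>2)"
    using FG by (intro integrable_cong_AE) auto
  then have G: "L2 G"
    using assms(2) by (simp add: L2_def Dom_def)
  have "Ent M F = Ent M G"
  proof -
    have "(\<integral>w. F w * ln (F w) \<partial>M) = (\<integral>w. G w * ln (G w) \<partial>M)"
      using FG by (intro integral_cong_AE) auto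
    moreover have "(\<integral>w. F w \<partial>M) = (\<integral>w. G w \<partial>M)"
      using FG by (intro integral_cong_AE) auto
    ultimately show ?thesis
      by (simp add: Ent_def)
  qed
  moreover have "(\<integral>\<^sup>+ w. ennreal (1 / F w) * l2_norm_sq (\<lambda>k. grad p k F w) \<partial>M)
      = (\<integral>\<^sup>+ w. ennreal (1 / G w) * l2_norm_sq (\<lambda>k. grad p k G w) \<partial>M)"
  proof (rule nn_integral_cong_AE)
    \<comment> \<open>The gradients read \<open>F\<close> at updated points, so almost sure equality
      must be transported through every update. Countably many coordinates allow one common null
      set.\<close>
    have "AE w in M. \<forall>k. F (w(k := 1)) = G (w(k := 1)) \<and> F (w(k := -1)) = G (w(k := -1))"
      unfolding AE_all_countable using AE_update[OF FG] by auto
    with FG show "AE w in M. ennreal (1 / F w) * l2_norm_sq (\<lambda>k. grad p k F w)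
        = ennreal (1 / G w) * l2_norm_sq (\<lambda>k. grad p k G w)"
      by eventually_elim (simp add: grad_def)
  qed
  moreover have "ereal (Ent M G) \<le> enn2ereal (\<Sum>k. ennreal (energy p k G))"
  \<comment> \<open>If the series diverges, the bound is trivial; otherwise its finite sum
    \<open>r\<close> dominates all partial sums.\<close>
  proof (cases "\<Sum>k. ennreal (energy p k G)")
    case (real r)
    have pos: "0 \<le> energy p k G" for k
    proof -
      have "0 \<le> G w" for w
        using assms(3) G_ge[of w] by linarith
      then show ?thesis
        unfolding energy_def by (intro integral_nonneg_AE) auto
    qed
    have "(\<Sum>k<n. energy p k G) \<le> r" for n
    proof -
      have "ennreal (\<Sum>k<n. energy p k G) = (\<Sum>k<n. ennreal (energy p k G))"
        using pos by simp
      also have "\<dots> \<le> ennreal r"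
        unfolding real(2)[symmetric] by (rule sum_le_suminf) auto
      finally show ?thesis
        using real(1) by simp
    qed
    then have "Ent M G \<le> r"
      by (rule Ent_le_sum_energy[OF G assms(3) G_ge])
    with real show ?thesis
      by simp
  qed simp
  ultimately show ?thesis
    using nn_integral_eq_suminf_energy[OF G assms(3) G_ge] by simp
qed

end
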